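(* Let $k\ge 1$ be a natural number, let $\alpha>1$ be a real number, and let $\mathcal F$ be a family of functions meromorphic on a domain $D\subseteq\mathbb C$ such that for every $f\in\mathcal F$ each pole of $f$ in $D$ has multiplicity at least $\frac{k}{\alpha-1}$. If $\mathcal F$ is normal in $D$, then the family $$\mathcal F_{k,\alpha}:=\left\{\frac{|f^{(k)}|}{1+|f|^\alpha}\;:\; f\in\mathcal F\right\}$$ is locally uniformly bounded in $D$.
   Context: A domain is a nonempty open connected subset of $\mathbb C$. A family $\mathcal F$ of meromorphic functions on $D$ is normal in $D$ if every sequence in $\mathcal F$ has a subsequence that converges uniformly on compact subsets of $D$ with respect to the spherical metric on $\overline{\mathbb C}=\mathbb C\cup\{\infty\}$; the limit function is either meromorphic on $D$ or identically $\infty$. The function $\frac{|f^{(k)}|}{1+|f|^\alpha}$, defined a priori off the poles of $f$, is understood to be continuously extended into the poles of $f$. A family of nonnegative real-valued functions on $D$ is locally uniformly bounded if every point of $D$ has a neighborhood $U\subseteq D$ and a constant $M<\infty$ such that every function of the family is bounded by $M$ on $U$. *)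

theory Defs
  imports "HOL-Complex_Analysis.Complex_Analysis"
begin

text \<open>
  A meromorphic function on \<open>D\<close> is a function \<open>f :: complex \<Rightarrow> complex\<close> with
  \<open>f nicely_meromorphic_on D\<close>: removable singularities are filled in, and the library puts the
  dummy value \<open>0\<close> at the poles. The actual value at a pole is \<open>\<infinity>\<close>, which is recovered by
  \<open>ext_val\<close> below. Values of \<open>f\<close> outside \<open>D\<close> are irrelevant.
\<close>

text \<open>The extended complex plane; \<open>None\<close> is the point \<open>\<infinity>\<close>.\<close>

type_synonym ext_complex = "complex option"

definition ext_val :: "(complex \<Rightarrow> complex) \<Rightarrow> complex \<Rightarrow> ext_complex" where
  "ext_val f z = (if is_pole f z then None else Some (f z))"

text \<open>
  The chordal distance is the Euclidean distance in \<open>\<real>\<^sup>3\<close> of the stereographic projections to the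
  unit sphere. The spherical distance is the length of the shorter great circle arc between these
  two points: a chord of length \<open>c\<close> subtends an arc of length \<open>2 * arcsin (c / 2)\<close>.
\<close>

fun chordal_dist :: "ext_complex \<Rightarrow> ext_complex \<Rightarrow> real" where
  "chordal_dist (Some z) (Some w) =
     2 * norm (z - w) / (sqrt (1 + (norm z)\<^sup>2) * sqrt (1 + (norm w)\<^sup>2))"
| "chordal_dist (Some z) None = 2 / sqrt (1 + (norm z)\<^sup>2)"
| "chordal_dist None (Some w) = 2 / sqrt (1 + (norm w)\<^sup>2)"
| "chordal_dist None None = 0"

definition spherical_dist :: "ext_complex \<Rightarrow> ext_complex \<Rightarrow> real" where
  "spherical_dist a b = 2 * arcsin (chordal_dist a b / 2)"

definition spherically_uniform_limit_on ::
  "complex set \<Rightarrow> (nat \<Rightarrow> complex \<Rightarrow> ext_complex) \<Rightarrow> (complex \<Rightarrow> ext_complex) \<Rightarrow> bool" where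
  "spherically_uniform_limit_on K f g \<longleftrightarrow>
     (\<forall>e>0. \<forall>\<^sub>F n in sequentially. \<forall>z\<in>K. spherical_dist (f n z) (g z) < e)"

text \<open>
  The limit \<open>g\<close> may be any function to the extended plane. That it is meromorphic or identically
  \<open>\<infinity>\<close> on a domain, if the \<open>f n\<close> are meromorphic there, is a theorem and not part of the definition.
\<close>

definition normal_family_in :: "complex set \<Rightarrow> (complex \<Rightarrow> complex) set \<Rightarrow> bool" where
  "normal_family_in D \<F> \<longleftrightarrow>
     (\<forall>f :: nat \<Rightarrow> complex \<Rightarrow> complex. range f \<subseteq> \<F> \<longrightarrow>
        (\<exists>r g. strict_mono (r :: nat \<Rightarrow> nat) \<and>
           (\<forall>K. compact K \<and> K \<subseteq> D \<longrightarrow>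
              spherically_uniform_limit_on K (\<lambda>n. ext_val (f (r n))) g)))"

definition locally_uniformly_bounded_in :: "complex set \<Rightarrow> (complex \<Rightarrow> real) set \<Rightarrow> bool" where
  "locally_uniformly_bounded_in D \<G> \<longleftrightarrow>
     (\<forall>z\<in>D. \<exists>U M. open U \<and> z \<in> U \<and> U \<subseteq> D \<and> (\<forall>g\<in>\<G>. \<forall>w\<in>U. \<bar>g w\<bar> \<le> M))"

definition deriv_quot_off_poles :: "nat \<Rightarrow> real \<Rightarrow> (complex \<Rightarrow> complex) \<Rightarrow> complex \<Rightarrow> real" where
  "deriv_quot_off_poles k \<alpha> f z = norm ((deriv ^^ k) f z) / (1 + norm (f z) powr \<alpha>)"

text \<open>
  The continuous extension into the poles. At a pole of multiplicity \<open>m\<close> the numerator has order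
  \<open>m + k\<close> and the denominator has order \<open>\<alpha> * m\<close>, so the limit exists if \<open>m \<ge> k / (\<alpha> - 1)\<close>.
\<close>

definition deriv_quot :: "nat \<Rightarrow> real \<Rightarrow> (complex \<Rightarrow> complex) \<Rightarrow> complex \<Rightarrow> real" where
  "deriv_quot k \<alpha> f z =
     (if is_pole f z then Lim (at z) (deriv_quot_off_poles k \<alpha> f)
      else deriv_quot_off_poles k \<alpha> f z)"

definition deriv_quot_family ::
  "nat \<Rightarrow> real \<Rightarrow> (complex \<Rightarrow> complex) set \<Rightarrow> (complex \<Rightarrow> real) set" where
  "deriv_quot_family k \<alpha> \<F> = {deriv_quot k \<alpha> f | f. f \<in> \<F>}"

end

theory Submission
  imports Defs
begin

text \<open>
  Write \<open>\<beta> = k / (\<alpha> - 1)\<close>. Normality makes the family equicontinuous on the sphere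
  (\<open>normal_family_equicontinuous\<close>). Hence every point of \<open>D\<close> has a disc, the same for all members
  \<open>f\<close> of the family, on which either \<open>\<bar>f\<bar> \<le> 8\<close> everywhere or \<open>\<bar>f\<bar> \<ge> 1\<close> off the poles.
  In the first case \<open>f\<close> is holomorphic and the Cauchy inequality bounds its \<open>k\<close>-th derivative on a
  smaller disc.

  In the second case the bound \<open>\<bar>(deriv ^^ k) f z\<bar> \<le> C * \<bar>f z\<bar> powr \<alpha>\<close> is needed with \<open>C\<close>
  independent of \<open>f\<close> (\<open>higher_deriv_bound_of_norm_ge_1\<close>). Again this is a Cauchy estimate, now on a disc
  of radius comparable to \<open>\<bar>f z\<bar> powr (- 1 / \<beta>)\<close>: if \<open>\<bar>f\<bar>\<close> is at most a multiple of \<open>\<bar>f z\<bar>\<close>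
  there, the estimate has the order \<open>\<bar>f z\<bar> powr (1 + k / \<beta>)\<close>, and \<open>1 + k / \<beta> = \<alpha>\<close>.

  That \<open>\<bar>f\<bar>\<close> grows at most by a bounded factor on this disc is a statement about \<open>h = 1 / f\<close>, a holomorphic function bounded
  by \<open>1\<close> all of whose zeros have order at least \<open>\<beta>\<close> (\<open>norm_ge_near_nonzero_point\<close>). Let \<open>t\<close> be
  the distance from \<open>z\<close> to the nearest zero. By the Schwarz lemma the multiplicity of that zero makes
  \<open>\<bar>h\<bar>\<close> at most of the order \<open>t powr \<beta>\<close> on the zero-free disc of radius \<open>t\<close>; and the
  Borel-Caratheodory inequality, applied to the logarithm of \<open>h\<close> normalised by this bound, shows that
  \<open>\<bar>h\<bar>\<close> changes only by a bounded factor over the distance \<open>\<bar>h z\<bar> powr (1 / \<beta>)\<close>. The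
  logarithm that this inequality loses is harmless because \<open>x * ln (1 / x)\<close> is bounded on \<open>{0<..1}\<close>.

  At the poles the bound carries over to the continuous extension, once the limit is known to exist
  (\<open>tendsto_deriv_quot_off_poles_at_pole\<close>).
\<close>

section \<open>Bounded holomorphic functions with multiple zeros\<close>

text \<open>
  The Schwarz lemma for a zero of higher order: dividing \<open>h\<close> by \<open>(w - a) ^ zorder h a\<close> leaves a
  holomorphic function, to which the maximum principle applies on the disc of radius \<open>R\<close>.
\<close>
lemma norm_le_power_zorder:
  fixes h :: "complex \<Rightarrow> complex"
  assumes holo: "h holomorphic_on S" and S: "open S" "connected S" "cball a R \<subseteq> S" and "0 < R"
    and bound: "\<And>w. w \<in> cball a R \<Longrightarrow> norm (h w) \<le> 1"
    and nz: "\<exists>w\<in>S. h w \<noteq> 0" and w: "w \<in> cball a R"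
  shows "norm (h w) \<le> (norm (w - a) / R) ^ nat (zorder h a)"
proof -
  define p where "p = nat (zorder h a)"
  define g where "g = zor_poly h a"
  have aS: "a \<in> S" using S \<open>0 < R\<close> by auto
  obtain s where s: "s > 0" "cball a s \<subseteq> S" "g holomorphic_on cball a s"
      "\<And>w. w \<in> cball a s \<Longrightarrow> h w = g w * (w - a) ^ p"
    using zorder_exist_zero[OF holo S(1,2) aS nz] unfolding g_def p_def by blast
  define G where "G z = (if z = a then g a else h z / (z - a) ^ p)" for z
  have "G holomorphic_on S - {a}"
    by (rule holomorphic_transform[of "\<lambda>z. h z / (z - a) ^ p"])
       (auto simp: G_def intro!: holomorphic_intros holomorphic_on_subset[OF holo])
  moreover have "G holomorphic_on ball a s"
    by (rule holomorphic_transform[of g])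
       (use s(4) in \<open>auto simp: G_def intro!: holomorphic_on_subset[OF s(3)]\<close>)
  ultimately have "G holomorphic_on (S - {a}) \<union> ball a s"
    by (intro holomorphic_on_Un) (use S in auto)
  moreover have "S \<subseteq> (S - {a}) \<union> ball a s" using s(1) by auto
  ultimately have G: "G holomorphic_on S" by (rule holomorphic_on_subset)
  have hG: "h z = G z * (z - a) ^ p" for z
    using s(1) s(4)[of a] by (auto simp: G_def)
  have "norm (G w) \<le> 1 / R ^ p"
  proof (rule maximum_modulus_frontier[of G "cball a R"])
    show "G holomorphic_on interior (cball a R)"
      by (rule holomorphic_on_subset[OF G]) (use S(3) in auto)
    show "continuous_on (closure (cball a R)) G"
      by (rule holomorphic_on_imp_continuous_on, rule holomorphic_on_subset[OF G])
         (use S(3) in auto)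
    fix z assume "z \<in> frontier (cball a R)"
    hence z: "norm (z - a) = R" using \<open>0 < R\<close> by (auto simp: dist_norm norm_minus_commute)
    hence "norm (h z) \<le> 1" by (intro bound) (auto simp: dist_norm norm_minus_commute)
    thus "norm (G z) \<le> 1 / R ^ p"
      using z \<open>0 < R\<close> unfolding hG[of z] norm_mult norm_power by (simp add: field_simps)
  qed (use w in auto)
  hence "norm (G w) * norm (w - a) ^ p \<le> 1 / R ^ p * norm (w - a) ^ p"
    by (intro mult_right_mono) auto
  thus ?thesis
    unfolding p_def[symmetric] hG[of w] norm_mult norm_power by (simp add: power_divide)
qed

text \<open>
  The Borel-Caratheodory inequality. The Moebius map \<open>v \<mapsto> (v - l z) / (v + cnj (l z))\<close> sends the
  left half-plane to the unit disc and \<open>l z\<close> to \<open>0\<close>, so the Schwarz lemma controls \<open>l\<close>. For a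
  logarithm \<open>l\<close> of a zero-free function this is a Harnack inequality.
\<close>
lemma borel_caratheodory_half_plane:
  fixes l :: "complex \<Rightarrow> complex"
  assumes holo: "l holomorphic_on ball z t" and neg: "\<And>w. w \<in> ball z t \<Longrightarrow> Re (l w) < 0"
    and w: "w \<in> ball z t"
  shows "norm (l w - l z) \<le> 2 * \<bar>Re (l z)\<bar> * norm (w - z) / (t - norm (w - z))"
proof -
  have dw: "norm (w - z) < t" using w by (simp add: dist_norm norm_minus_commute)
  hence t: "t > 0" using norm_ge_zero[of "w - z"] by linarith
  define L where "L u = l (z + of_real t * u)" for u
  define \<phi> where "\<phi> u = (L u - l z) / (L u + cnj (l z))" for u
  have in_ball: "z + of_real t * u \<in> ball z t" if "norm u < 1" for u
    using that t by (auto simp: dist_norm norm_mult)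
  have nz: "L u + cnj (l z) \<noteq> 0" if "norm u < 1" for u
  proof -
    have "Re (L u + cnj (l z)) < 0"
      using neg[OF in_ball[OF that]] neg[of z] t by (simp add: L_def)
    thus ?thesis by force
  qed
  have lt: "norm (L u - l z) < norm (L u + cnj (l z))" if "norm u < 1" for u
  proof -
    have "Re (L u) * Re (l z) > 0"
      using neg[OF in_ball[OF that]] neg[of z] t by (simp add: L_def mult_neg_neg)
    hence "(norm (L u - l z))\<^sup>2 < (norm (L u + cnj (l z)))\<^sup>2"
      unfolding cmod_power2 by (simp add: power2_eq_square algebra_simps)
    thus ?thesis by (rule power2_less_imp_less) simp
  qed
  have "(l \<circ> (\<lambda>u. z + of_real t * u)) holomorphic_on ball 0 1"
  proof (rule holomorphic_on_compose_gen[OF _ holo])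
    show "(\<lambda>u. z + of_real t * u) holomorphic_on ball 0 1" by (intro holomorphic_intros)
    show "(\<lambda>u. z + of_real t * u) ` ball 0 1 \<subseteq> ball z t"
      by (intro image_subsetI in_ball) (simp add: dist_norm)
  qed
  moreover have "l \<circ> (\<lambda>u. z + of_real t * u) = L" by (simp add: fun_eq_iff L_def)
  ultimately have "L holomorphic_on ball 0 1" by simp
  hence "\<phi> holomorphic_on ball 0 1"
    unfolding \<phi>_def using nz by (intro holomorphic_intros) auto
  moreover have "\<phi> 0 = 0" by (simp add: \<phi>_def L_def)
  moreover have "norm (\<phi> u) < 1" if "norm u < 1" for u
    using lt[OF that] nz[OF that] by (simp add: \<phi>_def norm_divide)
  moreover define u where "u = (w - z) / of_real t"
  have nu: "norm u = norm (w - z) / t" using t by (simp add: u_def norm_divide)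
  hence u1: "norm u < 1" using dw t by simp
  ultimately have le: "norm (\<phi> u) \<le> norm u"
    using Schwarz_Lemma(1) by blast
  have Lu: "L u = l w" using t by (simp add: L_def u_def)
  have "l w - l z = \<phi> u * (l w + cnj (l z))"
    using nz[OF u1] by (simp add: \<phi>_def Lu)
  hence "norm (l w - l z) \<le> norm u * norm (l w + cnj (l z))"
    using le by (metis mult_right_mono norm_ge_zero norm_mult)
  also have "l w + cnj (l z) = (l w - l z) + of_real (2 * Re (l z))"
    by (simp add: complex_eq_iff)
  also have "norm u * norm \<dots> \<le> norm u * (norm (l w - l z) + 2 * \<bar>Re (l z)\<bar>)"
    by (intro mult_left_mono order.trans[OF norm_triangle_ineq]) (auto simp: norm_mult)
  finally have "t * norm (l w - l z) \<le> norm (w - z) * (norm (l w - l z) + 2 * \<bar>Re (l z)\<bar>)"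
    using t by (simp add: nu field_simps)
  thus ?thesis using dw by (simp add: field_simps)
qed


text \<open>
  The radius \<open>t\<close> is the distance from \<open>z\<close> to the nearest zero of \<open>h\<close>, cut off at \<open>r\<close>. Within
  distance \<open>2 * t\<close> of a zero of order at least \<open>\<beta>\<close> the function is small, so on a zero-free disc
  that reaches up to such a zero the bound \<open>1\<close> improves to \<open>(t / r) powr \<beta>\<close>. It is this gain that
  makes the next lemma scale correctly when zeros of \<open>h\<close> lie close to \<open>z\<close>.
\<close>
lemma nearest_zero_disc:
  fixes h :: "complex \<Rightarrow> complex"
  assumes holo: "h holomorphic_on ball z0 (4 * r)" and r: "r > 0" and \<beta>: "\<beta> > 0"
    and bound: "\<And>w. w \<in> ball z0 (4 * r) \<Longrightarrow> norm (h w) \<le> 1"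
    and zeros: "\<And>a. a \<in> ball z0 (4 * r) \<Longrightarrow> h a = 0 \<Longrightarrow> \<beta> \<le> real_of_int (zorder h a)"
    and z: "z \<in> ball z0 r" and hz: "h z \<noteq> 0"
  obtains t where "0 < t" "t \<le> r"
    "\<And>w. w \<in> ball z t \<Longrightarrow> h w \<noteq> 0"
    "\<And>w. w \<in> ball z t \<Longrightarrow> norm (h w) \<le> (t / r) powr \<beta>"
proof -
  define Z where "Z = {w \<in> cball z r. h w = 0}"
  have sub: "cball z r \<subseteq> ball z0 (4 * r)"
  proof
    fix w assume "w \<in> cball z r"
    thus "w \<in> ball z0 (4 * r)"
      using z r dist_triangle[of z0 w z] by simp
  qed
  show thesis
  proof (cases "Z = {}")
    case True
    show thesis
    proof (rule that[of r])
      fix w assume w: "w \<in> ball z r"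
      show "h w \<noteq> 0" using True w by (auto simp: Z_def)
      show "norm (h w) \<le> (r / r) powr \<beta>" using bound[of w] subsetD[OF sub, of w] w r by auto
    qed (use r in auto)
  next
    case False
    have "continuous_on (cball z r) h"
      using holo sub holomorphic_on_imp_continuous_on holomorphic_on_subset by blast
    hence "closed Z"
      unfolding Z_def by (intro continuous_closed_preimage_constant) auto
    then obtain a where a: "a \<in> Z" "\<And>y. y \<in> Z \<Longrightarrow> dist z a \<le> dist z y"
      using False distance_attains_inf by blast
    define t where "t = dist z a"
    have t: "t > 0" "t \<le> r" using a hz by (auto simp: t_def Z_def)
    have az: "a \<in> ball z0 (4 * r)" "h a = 0" using a sub by (auto simp: Z_def)
    have sub2: "cball a (2 * r) \<subseteq> ball z0 (4 * r)"
    proof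
      fix w assume "w \<in> cball a (2 * r)"
      thus "w \<in> ball z0 (4 * r)"
        using z t(2) dist_triangle[of z0 w a] dist_triangle[of z0 a z] by (simp add: t_def)
    qed
    show thesis
    proof (rule that[OF t])
      fix w assume w: "w \<in> ball z t"
      show "h w \<noteq> 0"
      proof
        assume "h w = 0"
        hence "w \<in> Z" using w t by (auto simp: Z_def)
        thus False using a(2)[of w] w by (simp add: t_def)
      qed
      have wa: "dist w a \<le> 2 * t"
        using w dist_triangle[of w a z] by (simp add: t_def dist_commute)
      define p where "p = nat (zorder h a)"
      have p: "\<beta> \<le> real p" using zeros[OF az] \<beta> by (simp add: p_def)
      have q: "norm (w - a) / (2 * r) \<le> t / r" "t / r \<le> 1"
        using wa t r by (simp_all add: dist_norm field_simps)
      have "norm (h w) \<le> (norm (w - a) / (2 * r)) ^ p"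
        unfolding p_def
      proof (rule norm_le_power_zorder[OF holo open_ball connected_ball sub2])
        show "\<exists>w\<in>ball z0 (4 * r). h w \<noteq> 0" using hz sub r by force
      qed (use bound subsetD[OF sub2] wa t r in \<open>auto simp: dist_commute\<close>)
      also have "\<dots> \<le> (t / r) ^ p" using q r by (intro power_mono) auto
      also have "\<dots> = (t / r) powr real p" using t r by (simp add: powr_realpow)
      also have "\<dots> \<le> (t / r) powr \<beta>" using q t r p by (intro powr_mono') auto
      finally show "norm (h w) \<le> (t / r) powr \<beta>" .
    qed
  qed
qed

text \<open>
  \<open>\<bar>h\<bar>\<close> drops at most by a bounded factor on a disc about \<open>z\<close> of radius comparable to
  \<open>\<bar>h z\<bar> powr (1 / \<beta>)\<close>, as it does for \<open>h w = w powr \<beta>\<close>. The function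
  \<open>h / (exp 1 * (t / r) powr \<beta>)\<close> is zero-free and bounded by \<open>exp (- 1)\<close> on the disc of
  \<open>nearest_zero_disc\<close>; the Borel-Caratheodory inequality bounds the variation of its logarithm by
  \<open>2 * x * (1 + \<beta> * ln (1 / x))\<close> with \<open>x = r * \<bar>h z\<bar> powr (1 / \<beta>) / t \<le> 1\<close>, and
  \<open>x * ln (1 / x) \<le> 1\<close>. The constant depends on \<open>\<beta>\<close> alone.
\<close>
lemma norm_ge_near_nonzero_point:
  fixes h :: "complex \<Rightarrow> complex"
  assumes holo: "h holomorphic_on ball z0 (4 * r)" and r: "r > 0" and \<beta>: "\<beta> > 0"
    and bound: "\<And>w. w \<in> ball z0 (4 * r) \<Longrightarrow> norm (h w) \<le> 1"
    and zeros: "\<And>a. a \<in> ball z0 (4 * r) \<Longrightarrow> h a = 0 \<Longrightarrow> \<beta> \<le> real_of_int (zorder h a)"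
    and z: "z \<in> ball z0 r" and hz: "h z \<noteq> 0"
    and w: "norm (w - z) \<le> r / 2 * norm (h z) powr (1 / \<beta>)"
  shows "exp (- (2 + 2 * \<beta>)) * norm (h z) \<le> norm (h w)"
proof -
  obtain t where t: "0 < t" "t \<le> r" and nz: "\<And>w. w \<in> ball z t \<Longrightarrow> h w \<noteq> 0"
      and small: "\<And>w. w \<in> ball z t \<Longrightarrow> norm (h w) \<le> (t / r) powr \<beta>"
    using nearest_zero_disc[OF holo r \<beta> bound zeros z hz] by blast
  define \<delta> where "\<delta> = norm (h z) powr (1 / \<beta>)"
  define x where "x = r * \<delta> / t"
  \<comment> \<open>The factor \<open>exp 1\<close> keeps the logarithm \<open>l\<close> of \<open>h / M\<close> strictly inside the left half-plane.\<close>
  define M where "M = exp 1 * (t / r) powr \<beta>"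
  have \<delta>: "\<delta> > 0" "\<delta> powr \<beta> = norm (h z)"
    using hz \<beta> by (simp_all add: \<delta>_def powr_powr)
  have "\<delta> \<le> ((t / r) powr \<beta>) powr (1 / \<beta>)"
    unfolding \<delta>_def using small[of z] t \<beta> by (intro powr_mono2) auto
  also have "\<dots> = t / r" using t r \<beta> by (simp add: powr_powr)
  finally have x: "0 < x" "x \<le> 1" using \<delta> t r by (simp_all add: x_def field_simps)
  have d: "norm (w - z) \<le> x * t / 2" using w t by (simp add: x_def \<delta>_def)
  also have "\<dots> \<le> t / 2" using x t by simp
  finally have d2: "norm (w - z) \<le> t / 2" .
  hence wt: "w \<in> ball z t" using t by (simp add: dist_norm norm_minus_commute)
  have M: "M > 0" using t r by (simp add: M_def)
  have subt: "ball z t \<subseteq> ball z0 (4 * r)"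
  proof
    fix w assume "w \<in> ball z t"
    thus "w \<in> ball z0 (4 * r)" using z t r dist_triangle[of z0 w z] by simp
  qed
  obtain l where l: "l holomorphic_on ball z t"
      and el: "\<And>u. u \<in> ball z t \<Longrightarrow> h u / of_real M = exp (l u)"
  proof (rule contractible_imp_holomorphic_log[of "\<lambda>u. h u / of_real M" "ball z t"])
    show "(\<lambda>u. h u / of_real M) holomorphic_on ball z t"
      using M by (intro holomorphic_intros holomorphic_on_subset[OF holo subt]) auto
  qed (use nz M in \<open>auto intro: convex_imp_contractible\<close>)
  have nh: "norm (h u) = M * exp (Re (l u))" if "u \<in> ball z t" for u
    using arg_cong[OF el[OF that], of norm] M by (simp add: norm_divide field_simps)
  have neg: "Re (l u) \<le> -1" if "u \<in> ball z t" for u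
  proof -
    have "(t / r) powr \<beta> * exp (1 + Re (l u)) \<le> (t / r) powr \<beta> * 1"
      using small[OF that] nh[OF that] by (simp add: M_def exp_add mult_ac)
    hence "exp (1 + Re (l u)) \<le> exp 0" 
      using t r by (subst (asm) mult_le_cancel_left_pos) auto
    thus ?thesis by (simp only: exp_le_cancel_iff)
  qed
  have "norm (l w - l z) \<le> 2 * \<bar>Re (l z)\<bar> * norm (w - z) / (t - norm (w - z))"
    by (rule borel_caratheodory_half_plane[OF l]) (use neg wt in force)+
  also have "\<dots> = 2 * \<bar>Re (l z)\<bar> * (norm (w - z) / (t - norm (w - z)))" by simp
  also have "norm (w - z) / (t - norm (w - z)) \<le> x"
  proof -
    have "x * (t / 2) \<le> x * (t - norm (w - z))" using d2 x by (intro mult_left_mono) auto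
    thus ?thesis using d d2 t by (simp add: field_simps)
  qed
  also have "Re (l z) = - (1 + \<beta> * ln (1 / x))"
  proof -
    have "exp (Re (l z)) = norm (h z) / M" using nh[of z] t M by simp
    hence "Re (l z) = ln (norm (h z) / M)" by (metis ln_exp)
    also have "\<dots> = \<beta> * ln \<delta> - (1 + \<beta> * ln (t / r))"
      unfolding \<delta>(2)[symmetric] M_def using \<delta>(1) t r
      by (simp add: ln_div ln_mult ln_powr)
    also have "\<dots> = - (1 + \<beta> * ln (1 / x))"
      using \<delta>(1) t r by (simp add: x_def ln_div ln_mult algebra_simps)
    finally show ?thesis .
  qed
  also have "2 * \<bar>- (1 + \<beta> * ln (1 / x))\<bar> * x \<le> 2 + 2 * \<beta>"
  proof -
    have "ln (1 / x) \<le> 1 / x - 1" using x by (intro ln_le_minus_one) auto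
    hence "x * ln (1 / x) \<le> x * (1 / x - 1)" using x by (intro mult_left_mono) auto
    also have "\<dots> \<le> 1" using x by (simp add: algebra_simps)
    finally have "\<beta> * (x * ln (1 / x)) \<le> \<beta> * 1" using \<beta> by (intro mult_left_mono) auto
    moreover have "ln (1 / x) \<ge> 0" using x by simp
    hence "\<bar>- (1 + \<beta> * ln (1 / x))\<bar> = 1 + \<beta> * ln (1 / x)" using \<beta>
      by (smt (verit) mult_nonneg_nonneg)
    ultimately show ?thesis using x by (simp add: algebra_simps)
  qed
  finally have "norm (l w - l z) \<le> 2 + 2 * \<beta>" by (simp add: mult_left_mono)
  hence "Re (l z) - (2 + 2 * \<beta>) \<le> Re (l w)"
    using abs_Re_le_cmod[of "l w - l z"] by simp
  hence "M * exp (Re (l z) - (2 + 2 * \<beta>)) \<le> M * exp (Re (l w))" using M by simp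
  thus ?thesis using nh[OF wt] nh[of z] t by (simp add: exp_diff exp_minus exp_add field_simps)
qed

section \<open>Derivatives near infinity\<close>

lemma nicely_meromorphic_on_pole_eq_0:
  assumes "f nicely_meromorphic_on A" "z \<in> A" "is_pole f z"
  shows "f z = 0"
  using assms unfolding nicely_meromorphic_on_def is_pole_def
  by (metis not_tendsto_and_filterlim_at_infinity at_neq_bot)

text \<open>
  The heart of the matter near infinity. The reciprocal \<open>h = 1 / f\<close> is bounded by \<open>1\<close>, and its zeros
  are the poles of \<open>f\<close>, so \<open>norm_ge_near_nonzero_point\<close> bounds \<open>f\<close> by a multiple of \<open>\<bar>f z\<bar>\<close> on a
  disc of radius \<open>r / 2 * \<bar>f z\<bar> powr (- 1 / \<beta>)\<close>. The Cauchy inequality on that disc costs the factor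
  \<open>\<bar>f z\<bar> powr (k / \<beta>)\<close>. For \<open>\<beta> = k / (\<alpha> - 1)\<close> the resulting exponent \<open>1 + k / \<beta>\<close> is \<open>\<alpha>\<close>.
\<close>
lemma higher_deriv_bound_of_norm_ge_1:
  fixes f :: "complex \<Rightarrow> complex"
  assumes mero: "f nicely_meromorphic_on ball z0 (4 * r)" and r: "r > 0" and \<beta>: "\<beta> > 0"
    and large: "\<And>w. w \<in> ball z0 (4 * r) \<Longrightarrow> \<not> is_pole f w \<Longrightarrow> norm (f w) \<ge> 1"
    and poles: "\<And>a. a \<in> ball z0 (4 * r) \<Longrightarrow> is_pole f a \<Longrightarrow> \<beta> \<le> real_of_int (- zorder f a)"
    and z: "z \<in> ball z0 r" "\<not> is_pole f z"
  shows "norm ((deriv ^^ k) f z)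
           \<le> fact k * exp (2 + 2 * \<beta>) * (2 / r) ^ k * norm (f z) powr (1 + k / \<beta>)"
proof -
  define B where "B = ball z0 (4 * r)"
  note mero = mero[folded B_def] and large = large[folded B_def] and poles = poles[folded B_def]
  \<comment> \<open>At a pole \<open>f\<close> takes the value \<open>0\<close>, and \<open>inverse 0 = 0\<close> is the right value of \<open>h\<close> there.\<close>
  define h where "h w = inverse (f w)" for w
  have hm: "h nicely_meromorphic_on B"
    unfolding h_def by (rule nicely_meromorphic_on_inverse[OF mero])
  have h1: "norm (h w) \<le> 1" if "w \<in> B" for w
    using large[OF that] nicely_meromorphic_on_pole_eq_0[OF mero that]
    by (cases "is_pole f w") (auto simp: h_def norm_inverse intro!: inverse_le_1_iff[THEN iffD2])
  have h0: "is_pole f w" if "w \<in> B" "h w = 0" for w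
    using large[OF that(1)] that(2) by (auto simp: h_def)
  have "\<not> is_pole h w" if "w \<in> B" for w
  proof
    assume "is_pole h w"
    hence "eventually (\<lambda>u. norm (h u) \<ge> 2) (at w)"
      unfolding is_pole_def
      by (rule filterlim_at_infinity_imp_norm_at_top[THEN filterlim_at_top[THEN iffD1], rule_format])
    moreover have "eventually (\<lambda>u. u \<in> B) (at w)"
      using that by (intro eventually_at_in_open') (auto simp: B_def)
    ultimately have "eventually (\<lambda>u. False) (at w)"
      by eventually_elim (use h1 in force)
    thus False by simp
  qed
  hence han: "h analytic_on {w}" if "w \<in> B" for w
    using nicely_meromorphic_on_imp_analytic_at[OF hm that] that by blast
  hence hh: "h holomorphic_on B"
    by (meson analytic_imp_holomorphic analytic_on_analytic_at)
  have zB: "z \<in> B" using z r by (simp add: B_def)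
  have hz: "h z \<noteq> 0" using h0[OF zB] z by blast
  have zeros: "\<beta> \<le> real_of_int (zorder h a)" if a: "a \<in> B" "h a = 0" for a
  proof -
    have fm: "f meromorphic_on {a}"
      using mero a by (auto simp: nicely_meromorphic_on_def intro: meromorphic_on_subset)
    have "zorder h a = - zorder f a"
      unfolding h_def
    proof (rule zorder_inverse)
      show "isolated_singularity_at f a" "not_essential f a"
        using fm by (auto intro: meromorphic_on_isolated_singularity meromorphic_on_not_essential)
      show "\<exists>\<^sub>F w in at a. f w \<noteq> 0"
        using h0[OF a] non_zero_neighbour_pole by (intro eventually_frequently) auto
    qed
    thus ?thesis using poles[OF a(1) h0[OF a]] by simp
  qed
  define \<rho> where "\<rho> = r / 2 * norm (h z) powr (1 / \<beta>)"
  have \<rho>: "\<rho> > 0" using r hz by (simp add: \<rho>_def)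
  have "norm (h z) powr (1 / \<beta>) \<le> 1 powr (1 / \<beta>)"
    using h1[OF zB] \<beta> by (intro powr_mono2) auto
  hence \<rho>r: "\<rho> \<le> r / 2" using r by (simp add: \<rho>_def)
  have cmp: "exp (- (2 + 2 * \<beta>)) * norm (h z) \<le> norm (h w)" if "w \<in> cball z \<rho>" for w
  proof (rule norm_ge_near_nonzero_point[OF hh[unfolded B_def] r \<beta> h1[unfolded B_def] zeros[unfolded B_def] z(1) hz])
    show "norm (w - z) \<le> r / 2 * norm (h z) powr (1 / \<beta>)"
      using that by (simp add: \<rho>_def dist_norm norm_minus_commute)
  qed
  have sub: "cball z \<rho> \<subseteq> B"
  proof
    fix w assume "w \<in> cball z \<rho>"
    thus "w \<in> B" using z \<rho>r r dist_triangle[of z0 w z] by (simp add: B_def)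
  qed
  have fz: "f z \<noteq> 0" using hz by (simp add: h_def)
  have "0 < exp (- (2 + 2 * \<beta>)) * norm (h z)" using hz by simp
  hence hw: "h w \<noteq> 0" if "w \<in> cball z \<rho>" for w
    using cmp[OF that] by auto
  have fh: "f = (\<lambda>w. inverse (h w))" by (simp add: h_def)
  have fhol: "f holomorphic_on cball z \<rho>"
    unfolding fh using hw by (intro holomorphic_intros holomorphic_on_subset[OF hh sub]) auto
  have "norm ((deriv ^^ k) f z) \<le> fact k * (exp (2 + 2 * \<beta>) * norm (f z)) / \<rho> ^ k"
  proof (rule Cauchy_inequality)
    show "f holomorphic_on ball z \<rho>" by (rule holomorphic_on_subset[OF fhol]) auto
    show "continuous_on (cball z \<rho>) f" by (rule holomorphic_on_imp_continuous_on[OF fhol])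
    fix w assume "norm (z - w) = \<rho>"
    hence w: "w \<in> cball z \<rho>" by (simp add: dist_norm)
    have "f w \<noteq> 0" using hw[OF w] by (simp add: h_def)
    thus "norm (f w) \<le> exp (2 + 2 * \<beta>) * norm (f z)"
      using cmp[OF w] fz unfolding h_def norm_inverse exp_minus
      by (simp add: divide_simps mult.commute)
  qed (use \<rho> in auto)
  also have "\<rho> ^ k = (r / 2) ^ k * norm (f z) powr (- (k / \<beta>))"
  proof -
    have "norm (h z) powr (1 / \<beta>) = norm (f z) powr (- (1 / \<beta>))"
      by (simp add: h_def norm_inverse inverse_powr powr_minus)
    thus ?thesis
      using fz unfolding \<rho>_def power_mult_distrib by (simp add: powr_power)
  qed
  also have "fact k * (exp (2 + 2 * \<beta>) * norm (f z)) / ((r / 2) ^ k * norm (f z) powr (- (k / \<beta>)))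
      = fact k * exp (2 + 2 * \<beta>) * (2 / r) ^ k * (norm (f z) * norm (f z) powr (k / \<beta>))"
    using r by (simp add: powr_minus power_divide field_simps)
  also have "norm (f z) * norm (f z) powr (k / \<beta>) = norm (f z) powr (1 + k / \<beta>)"
    using fz by (simp add: powr_add)
  finally show ?thesis .
qed

section \<open>The quotient at a pole\<close>

lemma higher_deriv_at_pole_form:
  fixes f g :: "complex \<Rightarrow> complex"
  assumes g: "g holomorphic_on ball z r"
    and f: "\<And>w. w \<in> ball z r - {z} \<Longrightarrow> f w = g w / (w - z) ^ p"
  obtains G where "G holomorphic_on ball z r"
    "\<And>w. w \<in> ball z r - {z} \<Longrightarrow> (deriv ^^ k) f w = G w / (w - z) ^ (p + k)"
proof -
  have "\<exists>G. G holomorphic_on ball z r \<and>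
          (\<forall>w\<in>ball z r - {z}. (deriv ^^ k) f w = G w / (w - z) ^ (p + k))"
  proof (induction k)
    case 0
    show ?case using g f by auto
  next
    case (Suc k)
    then obtain G where G: "G holomorphic_on ball z r"
      "\<And>w. w \<in> ball z r - {z} \<Longrightarrow> (deriv ^^ k) f w = G w / (w - z) ^ (p + k)" by blast
    define q where "q = p + k"
    define H where "H w = deriv G w * (w - z) - of_nat q * G w" for w
    have "H holomorphic_on ball z r"
      unfolding H_def by (intro holomorphic_intros G(1)) auto
    moreover have "(deriv ^^ Suc k) f w = H w / (w - z) ^ (p + Suc k)"
      if w: "w \<in> ball z r - {z}" for w
    proof -
      have ev: "eventually (\<lambda>u. (deriv ^^ k) f u = G u / (u - z) ^ q) (nhds w)"
        unfolding q_def using w G(2) by (intro eventually_nhds_in_open[THEN eventually_mono, of "ball z r - {z}"]) auto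
      have "(G has_field_derivative deriv G w) (at w)"
        using G(1) w by (intro holomorphic_derivI[of G "ball z r"]) auto
      hence "((\<lambda>u. G u / (u - z) ^ q) has_field_derivative H w / (w - z) ^ Suc q) (at w)"
        using w
        by (auto intro!: derivative_eq_intros)
           (cases q; simp add: H_def divide_simps; simp add: algebra_simps)
      hence "deriv (\<lambda>u. G u / (u - z) ^ q) w = H w / (w - z) ^ Suc q"
        by (rule DERIV_imp_deriv)
      thus ?thesis using deriv_cong_ev[OF ev refl] by (simp add: q_def)
    qed
    ultimately show ?case by blast
  qed
  thus thesis using that by blast
qed

text \<open>
  With \<open>f w = g w / (w - z) ^ p\<close> and \<open>(deriv ^^ k) f w = G w / (w - z) ^ (p + k)\<close>, expanding the quotient by
  \<open>\<bar>w - z\<bar> powr (\<alpha> * p)\<close> leaves the power \<open>\<bar>w - z\<bar> powr (\<alpha> * p - p - k)\<close> in the numerator and a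
  denominator that tends to \<open>\<bar>g z\<bar> powr \<alpha> \<noteq> 0\<close>. The multiplicity condition says that this exponent is
  nonnegative. The limit must be known to exist, since \<open>Lim\<close> is unspecified otherwise.
\<close>
lemma tendsto_deriv_quot_off_poles_at_pole:
  fixes f :: "complex \<Rightarrow> complex"
  assumes holo: "f holomorphic_on S - {z}" and S: "open S" "z \<in> S" and pole: "is_pole f z"
    and \<alpha>: "\<alpha> > 1" and mult: "real k / (\<alpha> - 1) \<le> real_of_int (- zorder f z)"
  obtains l where "(deriv_quot_off_poles k \<alpha> f \<longlongrightarrow> l) (at z)"
proof -
  define p where "p = nat (- zorder f z)"
  define g where "g = zor_poly f z"
  obtain r where gz: "g z \<noteq> 0" and neg: "zorder f z < 0" and r: "r > 0" "g holomorphic_on cball z r"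
      and fg: "\<And>w. w \<in> cball z r - {z} \<Longrightarrow> f w = g w / (w - z) ^ p"
    using zorder_exist_pole[OF holo S pole] unfolding g_def p_def by blast
  obtain G where G: "G holomorphic_on ball z r"
    and fG: "\<And>w. w \<in> ball z r - {z} \<Longrightarrow> (deriv ^^ k) f w = G w / (w - z) ^ (p + k)"
    by (rule higher_deriv_at_pole_form[of g z r f p k])
       (use fg in \<open>auto intro!: holomorphic_on_subset[OF r(2)]\<close>)
  define e where "e = \<alpha> * p - p - k"
  have "real k \<le> real p * (\<alpha> - 1)" using mult \<alpha> neg by (simp add: p_def field_simps)
  hence e: "e \<ge> 0" by (simp add: e_def algebra_simps)
  define Q where "Q w = norm (G w) * norm (w - z) powr e
                          / (norm (w - z) powr (\<alpha> * p) + norm (g w) powr \<alpha>)" for w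
  have ev: "eventually (\<lambda>w. Q w = deriv_quot_off_poles k \<alpha> f w) (at z)"
  proof -
    have "eventually (\<lambda>w. w \<in> ball z r - {z}) (at z)"
      using r by (intro eventually_at_in_open) auto
    thus ?thesis
    proof eventually_elim
      case (elim w)
      define s where "s = norm (w - z)"
      have s: "s > 0" using elim by (simp add: s_def)
      have 1: "norm ((deriv ^^ k) f w) = norm (G w) / s powr (p + k)"
        using fG[OF elim] s by (simp add: norm_divide norm_power s_def powr_realpow flip: of_nat_add)
      have 2: "norm (f w) powr \<alpha> = norm (g w) powr \<alpha> / s powr (\<alpha> * p)"
        using fg[of w] elim s
        by (simp add: norm_divide norm_power powr_divide powr_powr mult.commute flip: s_def powr_realpow)
      have 3: "s powr e = s powr (\<alpha> * p) / s powr (p + k)"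
        by (simp add: e_def powr_diff[symmetric] algebra_simps)
      have "s powr (\<alpha> * p) + norm (g w) powr \<alpha> > 0" using s by (intro add_pos_nonneg) auto
      thus ?case
        unfolding deriv_quot_off_poles_def Q_def s_def[symmetric] 1 2 3
        using s by (simp add: divide_simps)
    qed
  qed
  have cont: "(G \<longlongrightarrow> G z) (at z)" "(g \<longlongrightarrow> g z) (at z)"
    using holomorphic_on_imp_continuous_on[OF G]
      holomorphic_on_imp_continuous_on[OF holomorphic_on_subset[OF r(2) ball_subset_cball]] r(1)
    by (auto simp: continuous_on_eq_continuous_at isCont_def)
  have dz: "((\<lambda>w. norm (w - z)) \<longlongrightarrow> 0) (at z)"
    by (rule tendsto_eq_intros tendsto_norm refl)+ simp
  have "p > 0" using neg by (simp add: p_def)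
  hence lim1: "((\<lambda>w. norm (w - z) powr (\<alpha> * p)) \<longlongrightarrow> 0) (at z)"
    using tendsto_powr'[OF dz tendsto_const, of "\<alpha> * p"] \<alpha> by simp
  \<comment> \<open>The limit \<open>c\<close> is \<open>1\<close> for \<open>e = 0\<close>, that is for the minimal multiplicity, and \<open>0\<close> otherwise.\<close>
  obtain c where lim2: "((\<lambda>w. norm (w - z) powr e) \<longlongrightarrow> c) (at z)"
  proof (cases "e = 0")
    case True
    have "eventually (\<lambda>w. 1 = norm (w - z) powr e) (at z)"
      by (rule eventually_mono[OF eventually_neq_at_within[of z]]) (use True in auto)
    thus thesis using that tendsto_eventually by (metis (mono_tags, lifting) eventually_mono)
  next
    case False
    thus thesis using tendsto_powr'[OF dz tendsto_const, of e] e that by auto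
  qed
  have "(Q \<longlongrightarrow> norm (G z) * c / (0 + norm (g z) powr \<alpha>)) (at z)"
    unfolding Q_def
    by (intro tendsto_intros tendsto_powr cont lim1 lim2) (use gz in auto)
  hence "(deriv_quot_off_poles k \<alpha> f \<longlongrightarrow> norm (G z) * c / (0 + norm (g z) powr \<alpha>)) (at z)"
    using tendsto_cong[OF ev] by simp
  thus thesis by (rule that)
qed

section \<open>Spherical equicontinuity of normal families\<close>

lemma chordal_dist_nonneg: "chordal_dist a b \<ge> 0"
  by (cases "(a, b)" rule: chordal_dist.cases) auto

lemma chordal_dist_le_2: "chordal_dist a b \<le> 2"
proof (cases "(a, b)" rule: chordal_dist.cases)
  case (1 z w)
  have "norm (z - w) \<le> norm z + norm w" by (rule norm_triangle_ineq4)
  also have "\<dots> \<le> sqrt ((1 + (norm z)\<^sup>2) * (1 + (norm w)\<^sup>2))"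
  proof (rule real_le_rsqrt)
    have "0 \<le> (1 - norm z * norm w)\<^sup>2" by simp
    thus "(norm z + norm w)\<^sup>2 \<le> (1 + (norm z)\<^sup>2) * (1 + (norm w)\<^sup>2)"
      by (simp add: power2_eq_square algebra_simps)
  qed
  also have "\<dots> = sqrt (1 + (norm z)\<^sup>2) * sqrt (1 + (norm w)\<^sup>2)" by (rule real_sqrt_mult)
  finally show ?thesis using 1 by (simp add: divide_le_eq add_pos_nonneg)
qed (auto simp: divide_le_eq add_pos_nonneg)

lemma chordal_dist_le_spherical_dist: "chordal_dist a b \<le> spherical_dist a b"
proof -
  define y where "y = arcsin (chordal_dist a b / 2)"
  have "y \<ge> 0" "sin y = chordal_dist a b / 2"
    using chordal_dist_nonneg[of a b] chordal_dist_le_2[of a b]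
    by (auto simp: y_def intro!: arcsin_nonneg)
  thus ?thesis using sin_x_le_x[of y] by (simp add: spherical_dist_def flip: y_def)
qed

text \<open>
  Spherical convergence enters the argument through the distance to \<open>\<infinity>\<close>, by this instance of the
  triangle inequality. For finite points it holds because \<open>sqrt (1 + x\<^sup>2)\<close>, the Euclidean norm of
  \<open>(1, x)\<close>, is \<open>1\<close>-Lipschitz in \<open>x\<close>.
\<close>
lemma chordal_dist_infinity_lipschitz:
  "\<bar>chordal_dist a None - chordal_dist b None\<bar> \<le> chordal_dist a b"
proof (cases "(a, b)" rule: chordal_dist.cases)
  case (1 z w)
  define A B where "A = sqrt (1 + (norm z)\<^sup>2)" and "B = sqrt (1 + (norm w)\<^sup>2)"
  have AB: "A > 0" "B > 0" by (auto simp: A_def B_def add_pos_nonneg)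
  have "A = norm (1::real, z)" "B = norm (1::real, w)" by (simp_all add: A_def B_def norm_Pair)
  hence "\<bar>B - A\<bar> \<le> norm ((1::real, w) - (1, z))" using norm_triangle_ineq3 by metis
  also have "\<dots> = norm (z - w)" by (simp add: norm_Pair norm_minus_commute)
  finally have "\<bar>B - A\<bar> \<le> norm (z - w)" .
  hence "2 * \<bar>B - A\<bar> / (A * B) \<le> 2 * norm (z - w) / (A * B)"
    using AB by (intro divide_right_mono) auto
  moreover have "2 / A - 2 / B = 2 * (B - A) / (A * B)" using AB by (simp add: field_simps)
  hence "\<bar>2 / A - 2 / B\<bar> = 2 * \<bar>B - A\<bar> / (A * B)"
    using AB by (simp only: abs_divide abs_mult abs_of_pos abs_numeral)
  ultimately show ?thesis
    using 1 by (simp flip: A_def B_def)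
qed auto

lemma isCont_chordal_dist_infinity:
  assumes mero: "f nicely_meromorphic_on A" and z: "z \<in> A"
  shows "isCont (\<lambda>w. chordal_dist (ext_val f w) None) z"
proof -
  have mz: "f meromorphic_on {z}"
    using mero z by (auto simp: nicely_meromorphic_on_def intro: meromorphic_on_subset)
  have "eventually (\<lambda>w. \<not> is_pole f w) (at z)"
    using eventually_not_pole meromorphic_on_isolated_singularity[OF mz] by blast
  hence ev: "eventually (\<lambda>w. 2 / sqrt (1 + (norm (f w))\<^sup>2) = chordal_dist (ext_val f w) None) (at z)"
    by eventually_elim (simp add: ext_val_def)
  have "((\<lambda>w. 2 / sqrt (1 + (norm (f w))\<^sup>2)) \<longlongrightarrow> chordal_dist (ext_val f z) None) (at z)"
  proof (cases "is_pole f z")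
    case True
    hence "filterlim (\<lambda>w. norm (f w)) at_top (at z)"
      unfolding is_pole_def by (rule filterlim_at_infinity_imp_norm_at_top)
    hence "((\<lambda>w. 2 / sqrt (1 + (norm (f w))\<^sup>2)) \<longlongrightarrow> 0) (at z)"
      by (rule filterlim_compose[rotated]) real_asymp
    thus ?thesis using True by (simp add: ext_val_def)
  next
    case False
    have "(f \<longlongrightarrow> f z) (at z)"
      using mero z False unfolding nicely_meromorphic_on_def by blast
    moreover have "sqrt (1 + (norm (f z))\<^sup>2) \<noteq> 0"
      by (metis add_pos_nonneg less_irrefl real_sqrt_eq_zero_cancel_iff zero_le_power2 zero_less_one)
    ultimately have "((\<lambda>w. 2 / sqrt (1 + (norm (f w))\<^sup>2)) \<longlongrightarrow> 2 / sqrt (1 + (norm (f z))\<^sup>2)) (at z)"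
      by (intro tendsto_intros) auto
    thus ?thesis using False by (simp add: ext_val_def)
  qed
  thus ?thesis
    unfolding isCont_def using tendsto_cong[OF ev] by blast
qed

text \<open>
  The easy half of the Arzela-Ascoli theorem, in the only form used below: for the distance to
  \<open>\<infinity>\<close>, a continuous real function even at poles. If equicontinuity at \<open>z\<close> failed along
  functions \<open>f n\<close> and points \<open>w n\<close> tending to \<open>z\<close>, a uniformly convergent subsequence could be compared
  with a single one of its members, which is continuous.
\<close>
lemma normal_family_equicontinuous:
  assumes normal: "normal_family_in D \<F>" and D: "open D" "z \<in> D" and \<epsilon>: "\<epsilon> > 0"
    and mero: "\<And>f. f \<in> \<F> \<Longrightarrow> f nicely_meromorphic_on D"
  obtains \<rho> where "\<rho> > 0" "ball z \<rho> \<subseteq> D"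
    "\<And>f w. f \<in> \<F> \<Longrightarrow> w \<in> ball z \<rho> \<Longrightarrow>
       \<bar>chordal_dist (ext_val f w) None - chordal_dist (ext_val f z) None\<bar> < \<epsilon>"
proof (rule ccontr)
  assume "\<not> thesis"
  define c where "c f w = chordal_dist (ext_val f w) None" for f w
  obtain R where R: "R > 0" "cball z R \<subseteq> D" using D open_contains_cball by blast
  have "\<exists>f w. f \<in> \<F> \<and> w \<in> ball z (R / Suc n) \<and> \<bar>c f w - c f z\<bar> \<ge> \<epsilon>" for n
  proof (rule ccontr)
    assume *: "\<not> ?thesis"
    have "R / Suc n \<le> R" using R by (simp add: divide_le_eq)
    hence "ball z (R / Suc n) \<subseteq> D" using R(2) by (meson ball_subset_cball subset_ball subset_trans)
    thus False using that[of "R / Suc n"] \<open>\<not> thesis\<close> R(1) * by (force simp: c_def not_le)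
  qed
  then obtain f w where f: "\<And>n. f n \<in> \<F>" and w: "\<And>n. w n \<in> ball z (R / Suc n)"
      and far: "\<And>n. \<bar>c (f n) (w n) - c (f n) z\<bar> \<ge> \<epsilon>" by metis
  have "range f \<subseteq> \<F>" using f by auto
  then obtain q g where q: "strict_mono (q :: nat \<Rightarrow> nat)"
      and lim: "\<And>K. compact K \<Longrightarrow> K \<subseteq> D \<Longrightarrow>
                  spherically_uniform_limit_on K (\<lambda>n. ext_val (f (q n))) g"
    using normal unfolding normal_family_in_def by metis
  define d where "d v = chordal_dist (g v) None" for v
  have "eventually (\<lambda>n. \<forall>v\<in>cball z R. spherical_dist (ext_val (f (q n)) v) (g v) < \<epsilon> / 5) sequentially"
  proof -
    have "\<epsilon> / 5 > 0" using \<epsilon> by simp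
    thus ?thesis
      using lim[OF compact_cball R(2)] unfolding spherically_uniform_limit_on_def by blast
  qed
  then obtain N where N: "\<And>n v. n \<ge> N \<Longrightarrow> v \<in> cball z R \<Longrightarrow>
                            spherical_dist (ext_val (f (q n)) v) (g v) < \<epsilon> / 5"
    unfolding eventually_sequentially by blast
  have cd: "\<bar>c (f (q n)) v - d v\<bar> < \<epsilon> / 5" if "n \<ge> N" "v \<in> cball z R" for n v
    unfolding c_def d_def
    using N[OF that] chordal_dist_infinity_lipschitz chordal_dist_le_spherical_dist
    by (meson le_less_trans)
  have "isCont (c (f (q N))) z"
    unfolding c_def by (rule isCont_chordal_dist_infinity[OF mero[OF f] D(2)])
  then obtain s where s: "s > 0" "\<And>v. dist v z < s \<Longrightarrow> \<bar>c (f (q N)) v - c (f (q N)) z\<bar> < \<epsilon> / 5"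
    unfolding continuous_at_eps_delta using \<epsilon> by (metis dist_real_def divide_pos_pos zero_less_numeral)
  have "(\<lambda>n. R / Suc n) \<longlonglongrightarrow> 0" by real_asymp
  hence "eventually (\<lambda>n. R / Suc n < s \<and> n \<ge> N) sequentially"
    using s(1) eventually_ge_at_top[of N] by (auto intro: order_tendstoD eventually_conj)
  then obtain n where n: "R / Suc n < s" "n \<ge> N" using eventually_happens by force
  define v where "v = w (q n)"
  have "R / Suc (q n) \<le> R / Suc n"
    using R(1) seq_suble[OF q, of n] by (intro divide_left_mono) auto
  moreover have "R / Suc n \<le> R" using R by (simp add: divide_le_eq)
  ultimately have v: "dist v z < s" "v \<in> cball z R" "z \<in> cball z R"
    using w[of "q n"] n(1) R(1) by (auto simp: v_def dist_commute)
  \<comment> \<open>Five comparisons, each with error below \<open>\<epsilon> / 5\<close>: from \<open>f (q n)\<close> through \<open>g\<close> to \<open>f (q N)\<close> at the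
    point \<open>v\<close>, from \<open>v\<close> to \<open>z\<close> along \<open>f (q N)\<close>, and back through \<open>g\<close> to \<open>f (q n)\<close> at \<open>z\<close>.\<close>
  show False
    using far[of "q n"] cd[OF n(2) v(2)] cd[OF n(2) v(3)] s(2)[OF v(1)]
      cd[OF order.refl v(2)] cd[OF order.refl v(3)]
    unfolding v_def[symmetric] by linarith
qed

section \<open>Local boundedness of the quotients\<close>

theorem theorem1:
  fixes k :: nat and \<alpha> :: real and D :: "complex set" and \<F> :: "(complex \<Rightarrow> complex) set"
  assumes "k \<ge> 1" and "\<alpha> > 1"
    and "open D" and "connected D" and "D \<noteq> {}"
    and "\<And>f. f \<in> \<F> \<Longrightarrow> f nicely_meromorphic_on D"
    and "\<And>f z. f \<in> \<F> \<Longrightarrow> z \<in> D \<Longrightarrow> is_pole f z \<Longrightarrow>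
           real_of_int (- zorder f z) \<ge> real k / (\<alpha> - 1)"
    and "normal_family_in D \<F>"
  shows "locally_uniformly_bounded_in D (deriv_quot_family k \<alpha> \<F>)"
  unfolding locally_uniformly_bounded_in_def
proof
  note mero = assms(6) and poles = assms(7)
  define \<beta> where "\<beta> = real k / (\<alpha> - 1)"
  have \<beta>: "\<beta> > 0" "1 + real k / \<beta> = \<alpha>" using assms(1,2) by (auto simp: \<beta>_def)
  fix z0 assume z0: "z0 \<in> D"
  obtain \<rho> where \<rho>: "\<rho> > 0" "ball z0 \<rho> \<subseteq> D"
    and osc: "\<And>f w. f \<in> \<F> \<Longrightarrow> w \<in> ball z0 \<rho> \<Longrightarrow>
       \<bar>chordal_dist (ext_val f w) None - chordal_dist (ext_val f z0) None\<bar> < 1 / 4"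
    using normal_family_equicontinuous[OF assms(8,3) z0 _ mero, of "1 / 4"] by auto
  define r where "r = \<rho> / 4"
  have r: "r > 0" and r4: "4 * r = \<rho>" using \<rho> by (auto simp: r_def)
  define C where "C = max (fact k * 8 / r ^ k) (fact k * exp (2 + 2 * \<beta>) * (2 / r) ^ k)"
  have C0: "C \<ge> 0" using r by (auto simp: C_def intro!: max.coboundedI1)
  \<comment> \<open>Whether \<open>f z0\<close> is near \<open>\<infinity>\<close> decides which bound applies on the disc: a distance to \<open>\<infinity>\<close> below \<open>1\<close>
    forces \<open>\<bar>f\<bar> \<ge> 1\<close> off the poles, and one above \<open>1 / 4\<close> forces \<open>\<bar>f\<bar> \<le> 8\<close>.\<close>
  have off: "deriv_quot_off_poles k \<alpha> f w \<le> C"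
    if f: "f \<in> \<F>" and w: "w \<in> ball z0 r" and np: "\<not> is_pole f w" for f w
  proof (cases "chordal_dist (ext_val f z0) None < 1 / 2")
    case True
    have large: "norm (f u) \<ge> 1" if "u \<in> ball z0 (4 * r)" "\<not> is_pole f u" for u
    proof (rule ccontr)
      assume "\<not> norm (f u) \<ge> 1"
      hence "(norm (f u))\<^sup>2 \<le> 1" by (intro power_le_one) auto
      hence "sqrt (1 + (norm (f u))\<^sup>2) \<le> sqrt 4" by (intro real_sqrt_le_mono) simp
      hence "chordal_dist (ext_val f u) None \<ge> 1"
        using that(2) by (simp add: ext_val_def le_divide_eq add_pos_nonneg)
      thus False using True osc[OF f that(1)[unfolded r4]] by linarith
    qed
    have "norm ((deriv ^^ k) f w)
            \<le> fact k * exp (2 + 2 * \<beta>) * (2 / r) ^ k * norm (f w) powr (1 + k / \<beta>)"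
    proof (rule higher_deriv_bound_of_norm_ge_1[OF _ r \<beta>(1) large])
      show "f nicely_meromorphic_on ball z0 (4 * r)"
        using mero[OF f] \<rho>(2) r4 nicely_meromorphic_on_subset by metis
    qed (use poles[OF f] \<rho>(2) r4 w np in \<open>auto simp: \<beta>_def\<close>)
    also have "\<dots> \<le> C * (1 + norm (f w) powr \<alpha>)"
      unfolding \<beta>(2) using C0 by (intro mult_mono) (auto simp: C_def)
    finally show ?thesis
      by (simp add: deriv_quot_off_poles_def divide_le_eq add_pos_nonneg)
  next
    case False
    have far: "chordal_dist (ext_val f u) None > 1 / 4" if "u \<in> ball z0 (4 * r)" for u
      using False osc[OF f that[unfolded r4]] by linarith
    have sub: "cball w r \<subseteq> ball z0 (4 * r)"
    proof
      fix u assume "u \<in> cball w r"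
      thus "u \<in> ball z0 (4 * r)" using w r dist_triangle[of z0 u w] by simp
    qed
    have small: "\<not> is_pole f u" "norm (f u) \<le> 8" if "u \<in> ball z0 (4 * r)" for u
    proof -
      show np: "\<not> is_pole f u" using far[OF that] by (auto simp: ext_val_def)
      have "1 / 4 < 2 / sqrt (1 + (norm (f u))\<^sup>2)" using far[OF that] np by (simp add: ext_val_def)
      hence "sqrt (1 + (norm (f u))\<^sup>2) < 8" by (simp add: less_divide_eq add_pos_nonneg)
      moreover have "norm (f u) \<le> sqrt (1 + (norm (f u))\<^sup>2)" by (intro real_le_rsqrt) simp
      ultimately show "norm (f u) \<le> 8" by linarith
    qed
    have "f analytic_on {u}" if "u \<in> ball z0 (4 * r)" for u
      using nicely_meromorphic_on_imp_analytic_at[OF mero[OF f]] small(1)[OF that] that \<rho>(2) r4 by blast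
    hence hol: "f holomorphic_on ball z0 (4 * r)"
      by (meson analytic_imp_holomorphic analytic_on_analytic_at)
    have "norm ((deriv ^^ k) f w) \<le> fact k * 8 / r ^ k"
    proof (rule Cauchy_inequality)
      show "f holomorphic_on ball w r" using hol sub by (meson ball_subset_cball holomorphic_on_subset subset_trans)
      show "continuous_on (cball w r) f"
        using hol sub holomorphic_on_imp_continuous_on holomorphic_on_subset by blast
      show "norm (f u) \<le> 8" if "norm (w - u) = r" for u
        using that sub by (intro small(2)) (auto simp: dist_norm subset_iff)
    qed (rule r)
    also have "\<dots> \<le> C * 1" by (simp add: C_def)
    also have "\<dots> \<le> C * (1 + norm (f w) powr \<alpha>)" using C0 by (intro mult_left_mono) auto
    finally show ?thesis
      by (simp add: deriv_quot_off_poles_def divide_le_eq add_pos_nonneg)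
  qed
  have off0: "0 \<le> deriv_quot_off_poles k \<alpha> f w" for f w
    by (simp add: deriv_quot_off_poles_def)
  \<comment> \<open>At a pole the bound passes to the limit from the nearby points, which are not poles.\<close>
  have "\<bar>deriv_quot k \<alpha> f w\<bar> \<le> C" if f: "f \<in> \<F>" and w: "w \<in> ball z0 r" for f w
  proof (cases "is_pole f w")
    case False
    thus ?thesis using off[OF f w] off0[of f w] by (simp add: deriv_quot_def)
  next
    case True
    have wD: "w \<in> D" using w r \<rho>(2) by (auto simp: r_def)
    have "isolated_singularity_at f w"
      using mero[OF f] wD unfolding nicely_meromorphic_on_def
      by (meson meromorphic_on_isolated_singularity meromorphic_on_subset empty_subsetI insert_subset)
    then obtain s where s: "s > 0" "f analytic_on ball w s - {w}"
      unfolding isolated_singularity_at_def by blast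
    obtain l where l: "(deriv_quot_off_poles k \<alpha> f \<longlongrightarrow> l) (at w)"
      by (rule tendsto_deriv_quot_off_poles_at_pole[OF analytic_imp_holomorphic[OF s(2)] _ _ True assms(2)
            poles[OF f wD True]]) (use s in auto)
    have "eventually (\<lambda>u. u \<in> ball z0 r) (at w)"
      using w by (intro eventually_at_in_open') auto
    moreover have "eventually (\<lambda>u. \<not> is_pole f u) (at w)"
      by (rule eventually_not_pole) fact
    ultimately have "eventually (\<lambda>u. deriv_quot_off_poles k \<alpha> f u \<le> C) (at w)"
      by eventually_elim (rule off[OF f])
    hence "l \<le> C" using tendsto_upperbound[OF l] by simp
    moreover have "l \<ge> 0" using tendsto_lowerbound[OF l, of 0] off0 by simp
    moreover have "Lim (at w) (deriv_quot_off_poles k \<alpha> f) = l" by (rule tendsto_Lim[OF _ l]) simp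
    ultimately show ?thesis using True by (simp add: deriv_quot_def)
  qed
  hence "\<forall>g\<in>deriv_quot_family k \<alpha> \<F>. \<forall>w\<in>ball z0 r. \<bar>g w\<bar> \<le> C"
    unfolding deriv_quot_family_def by blast
  moreover have "ball z0 r \<subseteq> D" using r \<rho>(2) by (auto simp: r_def)
  ultimately show "\<exists>U M. open U \<and> z0 \<in> U \<and> U \<subseteq> D \<and> (\<forall>g\<in>deriv_quot_family k \<alpha> \<F>. \<forall>w\<in>U. \<bar>g w\<bar> \<le> M)"
    using r by (intro exI[of _ "ball z0 r"] exI[of _ C]) auto
qed

end
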